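(* The operators $D_i$ ($i=0,\dots,r$) and $s_i$ ($i=1,\dots,r$) acting on $V=\bigoplus_{\boldsymbol m,\boldsymbol l,k}V(\boldsymbol m,\boldsymbol l,k)$ satisfy $$D_iD_j=D_jD_i\quad(i,j\in\{0,\dots,r\}),\qquad s_iD_j=D_{s_i(j)}s_i\quad(i\in\{1,\dots,r\},\ j\in\{0,\dots,r\}),$$ whenever applied to a summand $V(\boldsymbol m,\boldsymbol l,k)$ for which all the spaces involved are defined.
   Context: Fix $r\ge1$; put $l_0=k$, $l_{r+1}=0$; $\boldsymbol m=(m_1,\dots,m_r)\in\mathbb C^r$, $\boldsymbol l=(l_1,\dots,l_r)$, with integers $k\ge l_1\ge\dots\ge l_r\ge0$. Put $c_i(\boldsymbol m)=\sum_{s=1}^im_s+i$, $e_i(\boldsymbol m,\boldsymbol l,k)=k+c_i(\boldsymbol m)-l_i+l_{i+1}$, and $$D_i(\boldsymbol m,\boldsymbol l,k)=x(x-1)\frac{d}{dx}-e_i(\boldsymbol m,\boldsymbol l,k)(x-1)-k-1,\quad i=0,\dots,r.$$ Let $\boldsymbol 1_i\in\mathbb Z^r$ have $i$ ones followed by zeros, and let $$D_{\boldsymbol m,\boldsymbol l,k}=D_{j(k)}\Big(\boldsymbol m,\sum_{s=1}^{k-1}\boldsymbol 1_{j(s)},k-1\Big)\cdots D_{j(1)}(\boldsymbol m,\boldsymbol 0,0)$$ for any sequence $j(s)\in\{0,\dots,r\}$ with $\sum_{s=1}^k\boldsymbol 1_{j(s)}=\boldsymbol l$ (independent of the order). Let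 $v_i(\boldsymbol m,\boldsymbol l,k)$ be the monic polynomial of degree $k-l_i+l_{i+1}$ proportional to $x^{-c_i(\boldsymbol m)}D_{\boldsymbol m,\boldsymbol l,k}(x^{c_i(\boldsymbol m)})$. The parameters are called admissible if all $v_i(\boldsymbol m,\boldsymbol l,k)$, $i=0,\dots,r$, are well defined (i.e. these expressions have exactly the stated degrees) and the functions $v_i(\boldsymbol m,\boldsymbol l,k)x^{c_i(\boldsymbol m)}$, $i=0,\dots,r$, are linearly independent; then $V(\boldsymbol m,\boldsymbol l,k)$ denotes the space of functions with this basis. $V$ is the (disjoint, i.e. external) direct sum of the spaces $V(\boldsymbol m,\boldsymbol l,k)$ over all admissible parameters. $D_i$ acts on $V$ by $D_i:V(\boldsymbol m,\boldsymbol l,k)\to V(\boldsymbol m,\boldsymbol l+\boldsymbol 1_i,k+1)$, its restriction to $V(\boldsymbol m,\boldsymbol l,k)$ being the differential operator $D_i(\boldsymbol m,\boldsymbol l,k)$. For $i=1,\dots,r$ let $s_i$ also denote the transposition of $i-1$ and $i$ in the set $\{0,\dots,r\}$; put $$s_i\cdot\boldsymbol m=(m_1,\dots,m_{i-2},m_{i-1}+m_i+1,-m_i-2,m_{i+1}+m_i+1,m_{i+2},\dots,m_r),\quad (s_i)_k\boldsymbol l=(l_1,\dots,l_{i-1},l_{i-1}+l_{i+1}-l_i,l_{i+1},\dots,l_r)$$ (entries with index outside $1,\dots,r$ are omitted in the first formula). The operator $s_i:V(\boldsymbol m,\boldsymbol l,k)\to V(s_i\cdot\boldsymbol m,(s_i)_k\boldsymbol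 l,k)$ is the linear map with $$v_j(\boldsymbol m,\boldsymbol l,k)\,x^{c_j(\boldsymbol m)}\mapsto v_{s_i(j)}(s_i\cdot\boldsymbol m,(s_i)_k\boldsymbol l,k)\,x^{c_{s_i(j)}(s_i\cdot\boldsymbol m)},\qquad j=0,\dots,r.$$ *)

theory Defs
  imports
    "HOL-Complex_Analysis.Complex_Analysis"
    "HOL-Computational_Algebra.Polynomial"
    "HOL-Combinatorics.Transposition"
    "HOL-Library.Function_Algebras"
begin

section \<open>Functions on the slit plane\<close>

text \<open>
  Powers of \<open>x\<close> with complex exponent are taken as holomorphic functions on the slit plane (principal
  branch). A function on the slit plane is represented by a total function that vanishes outside, so
  that equality of functions on the slit plane is HOL equality.
\<close>

definition slit :: "complex set" where
  "slit = - \<real>\<^sub>\<le>\<^sub>0"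

type_synonym cfun = "complex \<Rightarrow> complex"

definition cpow :: "complex \<Rightarrow> cfun" where
  "cpow c = (\<lambda>z. if z \<in> slit then z powr c else 0)"

definition fscale :: "complex \<Rightarrow> cfun \<Rightarrow> cfun" where
  "fscale a f = (\<lambda>z. a * f z)"

interpretation cfun: vector_space fscale
  by unfold_locales (auto simp: fscale_def algebra_simps)


section \<open>Parameters\<close>

text \<open>
  The tuples \<open>m\<close> and \<open>l\<close> are functions on the indices \<open>1, \<dots>, r\<close>, extended by zero to all
  natural numbers; the conventions for \<open>l\<close> at the indices \<open>0\<close> and \<open>r + 1\<close> are in \<open>lext\<close>.
\<close>

type_synonym param = "(nat \<Rightarrow> complex) \<times> (nat \<Rightarrow> int) \<times> nat"

definition lext :: "nat \<Rightarrow> (nat \<Rightarrow> int) \<Rightarrow> nat \<Rightarrow> nat \<Rightarrow> int" where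
  "lext r l k i = (if i = 0 then int k else if i \<le> r then l i else 0)"

definition params :: "nat \<Rightarrow> param set" where
  "params r = {(m, l, k). (\<forall>n. n \<notin> {1..r} \<longrightarrow> m n = 0 \<and> l n = 0) \<and>
     (\<forall>i\<le>r. lext r l k i \<ge> lext r l k (i + 1))}"

definition cc :: "(nat \<Rightarrow> complex) \<Rightarrow> nat \<Rightarrow> complex" where
  "cc m i = (\<Sum>s=1..i. m s) + of_nat i"

definition dd :: "nat \<Rightarrow> (nat \<Rightarrow> int) \<Rightarrow> nat \<Rightarrow> nat \<Rightarrow> int" where
  "dd r l k i = int k - lext r l k i + lext r l k (i + 1)"

definition ee :: "nat \<Rightarrow> param \<Rightarrow> nat \<Rightarrow> complex" where
  "ee r = (\<lambda>(m, l, k) i. of_nat k + cc m i - of_int (lext r l k i) + of_int (lext r l k (i + 1)))"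

definition ones :: "nat \<Rightarrow> nat \<Rightarrow> int" where
  "ones i n = (if 1 \<le> n \<and> n \<le> i then 1 else 0)"

definition raise :: "nat \<Rightarrow> param \<Rightarrow> param" where
  "raise i = (\<lambda>(m, l, k). (m, (\<lambda>n. l n + ones i n), k + 1))"


section \<open>The differential operators and the spaces\<close>

definition diffop :: "nat \<Rightarrow> nat \<Rightarrow> param \<Rightarrow> cfun \<Rightarrow> cfun" where
  "diffop r i p f = (\<lambda>z. if z \<in> slit
     then z * (z - 1) * deriv f z - ee r p i * (z - 1) * f z - of_nat (snd (snd p)) * f z - f z
     else 0)"

text \<open>
  For a list \<open>j\<^sub>1, \<dots>, j\<^sub>n\<close> the operator with index \<open>j\<^sub>1\<close> is applied first.
\<close>

fun diffops :: "nat \<Rightarrow> nat list \<Rightarrow> param \<Rightarrow> cfun \<Rightarrow> cfun" where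
  "diffops r [] p f = f"
| "diffops r (j # js) p f = diffops r js (raise j p) (diffop r j p f)"

definition index_seq :: "nat \<Rightarrow> (nat \<Rightarrow> int) \<Rightarrow> nat \<Rightarrow> nat list \<Rightarrow> bool" where
  "index_seq r l k js \<longleftrightarrow> length js = k \<and> set js \<subseteq> {0..r} \<and> (\<forall>n. (\<Sum>s<k. ones (js ! s) n) = l n)"

text \<open>
  The choice of the sequence does not matter on holomorphic functions, see lemma
  \<open>full_diffop_eq\<close> below.
\<close>

definition full_diffop :: "nat \<Rightarrow> param \<Rightarrow> cfun \<Rightarrow> cfun" where
  "full_diffop r = (\<lambda>(m, l, k). diffops r (SOME js. index_seq r l k js) (m, (\<lambda>_. 0), 0))"

definition is_vpoly :: "nat \<Rightarrow> param \<Rightarrow> nat \<Rightarrow> complex poly \<Rightarrow> bool" where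
  "is_vpoly r = (\<lambda>(m, l, k) i v. lead_coeff v = 1 \<and> int (degree v) = dd r l k i \<and>
     (\<exists>a. a \<noteq> 0 \<and> (\<forall>z\<in>slit. z powr (- cc m i) * full_diffop r (m, l, k) (cpow (cc m i)) z = a * poly v z)))"

definition vpoly :: "nat \<Rightarrow> param \<Rightarrow> nat \<Rightarrow> complex poly" where
  "vpoly r p i = (THE v. is_vpoly r p i v)"

definition vfun :: "nat \<Rightarrow> param \<Rightarrow> nat \<Rightarrow> cfun" where
  "vfun r p i = (\<lambda>z. poly (vpoly r p i) z * cpow (cc (fst p) i) z)"

text \<open>Injectivity expresses independence of the family rather than of its range only.\<close>

definition admissible :: "nat \<Rightarrow> param \<Rightarrow> bool" where
  "admissible r p \<longleftrightarrow> p \<in> params r \<and> (\<forall>i\<le>r. \<exists>v. is_vpoly r p i v) \<and>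
     inj_on (vfun r p) {0..r} \<and> cfun.independent (vfun r p ` {0..r})"

definition V :: "nat \<Rightarrow> param \<Rightarrow> cfun set" where
  "V r p = cfun.span (vfun r p ` {0..r})"


section \<open>The external direct sum and the operators on it\<close>

definition Vsum :: "nat \<Rightarrow> (param \<Rightarrow> cfun) set" where
  "Vsum r = {F. finite {p. F p \<noteq> 0} \<and> (\<forall>p. F p \<noteq> 0 \<longrightarrow> admissible r p \<and> F p \<in> V r p)}"

definition summand :: "nat \<Rightarrow> param \<Rightarrow> (param \<Rightarrow> cfun) set" where
  "summand r p = {F \<in> Vsum r. \<forall>q. q \<noteq> p \<longrightarrow> F q = 0}"

text \<open>
  The operator on families induced by linear maps \<open>T p\<close> from the component \<open>p\<close> to the component \<open>g p\<close>.
\<close>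

definition lift_op :: "(param \<Rightarrow> param) \<Rightarrow> (param \<Rightarrow> cfun \<Rightarrow> cfun) \<Rightarrow> (param \<Rightarrow> cfun) \<Rightarrow> (param \<Rightarrow> cfun)" where
  "lift_op g T F = (\<lambda>q. \<Sum>p | F p \<noteq> 0 \<and> g p = q. T p (F p))"

definition D :: "nat \<Rightarrow> nat \<Rightarrow> (param \<Rightarrow> cfun) \<Rightarrow> (param \<Rightarrow> cfun)" where
  "D r i = lift_op (raise i) (diffop r i)"

definition s_perm :: "nat \<Rightarrow> nat \<Rightarrow> nat" where
  "s_perm i = Transposition.transpose (i - 1) i"

definition s_m :: "nat \<Rightarrow> nat \<Rightarrow> (nat \<Rightarrow> complex) \<Rightarrow> (nat \<Rightarrow> complex)" where
  "s_m r i m = (\<lambda>n. if n \<notin> {1..r} then 0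
     else if n = i then - m i - 2
     else if n + 1 = i \<or> n = i + 1 then m n + m i + 1
     else m n)"

definition s_l :: "nat \<Rightarrow> nat \<Rightarrow> nat \<Rightarrow> (nat \<Rightarrow> int) \<Rightarrow> (nat \<Rightarrow> int)" where
  "s_l r i k l = l(i := lext r l k (i - 1) + lext r l k (i + 1) - l i)"

definition s_param :: "nat \<Rightarrow> nat \<Rightarrow> param \<Rightarrow> param" where
  "s_param r i = (\<lambda>(m, l, k). (s_m r i m, s_l r i k l, k))"

text \<open>
  The library's linear maps are total; the values outside \<open>V r p\<close> of the chosen extension are irrelevant.
\<close>

definition s_map :: "nat \<Rightarrow> nat \<Rightarrow> param \<Rightarrow> cfun \<Rightarrow> cfun" where
  "s_map r i p = (SOME T. Vector_Spaces.linear fscale fscale T \<and>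
     (\<forall>j\<le>r. T (vfun r p j) = vfun r (s_param r i p) (s_perm i j)))"

definition S :: "nat \<Rightarrow> nat \<Rightarrow> (param \<Rightarrow> cfun) \<Rightarrow> (param \<Rightarrow> cfun)" where
  "S r i = lift_op (s_param r i) (s_map r i)"


section \<open>Independence of the order\<close>

lemma open_slit: "open slit"
  by (simp add: slit_def open_Compl)

lemma diffop_holomorphic: "f holomorphic_on slit \<Longrightarrow> diffop r i p f holomorphic_on slit"
  by (rule holomorphic_transform[where f = "\<lambda>z. z * (z - 1) * deriv f z - ee r p i * (z - 1) * f z
        - of_nat (snd (snd p)) * f z - f z"])
     (auto simp: diffop_def intro!: holomorphic_intros open_slit)

lemma deriv_diffop:
  assumes f: "f holomorphic_on slit" and z: "z \<in> slit"
  shows "deriv (diffop r i p f) z =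
    (2 * z - 1) * deriv f z + z * (z - 1) * deriv (deriv f) z
    - ee r p i * f z - ee r p i * (z - 1) * deriv f z - of_nat (snd (snd p) + 1) * deriv f z"
proof -
  have f1: "(f has_field_derivative deriv f z) (at z)"
    using f z open_slit by (metis holomorphic_derivI)
  have f2: "(deriv f has_field_derivative deriv (deriv f) z) (at z)"
    using holomorphic_deriv[OF f open_slit] z open_slit by (metis holomorphic_derivI)
  have "((\<lambda>z. z * (z - 1) * deriv f z - ee r p i * (z - 1) * f z - of_nat (snd (snd p)) * f z - f z)
      has_field_derivative ((2 * z - 1) * deriv f z + z * (z - 1) * deriv (deriv f) z
    - ee r p i * f z - ee r p i * (z - 1) * deriv f z - of_nat (snd (snd p) + 1) * deriv f z)) (at z)"
    by (rule derivative_eq_intros f1 f2 refl | simp)+ (simp add: algebra_simps)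
  then have "(diffop r i p f has_field_derivative ((2 * z - 1) * deriv f z + z * (z - 1) * deriv (deriv f) z
    - ee r p i * f z - ee r p i * (z - 1) * deriv f z - of_nat (snd (snd p) + 1) * deriv f z)) (at z)"
    by (rule has_field_derivative_transform_within_open[OF _ open_slit z]) (simp add: diffop_def)
  then show ?thesis by (rule DERIV_imp_deriv)
qed

lemma ee_raise:
  assumes "i \<le> r" "j \<le> r" "i \<noteq> j"
  shows "ee r (raise j p) i = ee r p i + 1"
  using assms by (cases p) (auto simp: ee_def raise_def lext_def ones_def)

lemma raise_commute: "raise i (raise j p) = raise j (raise i p)"
  by (cases p) (auto simp: raise_def)

lemma diffop_commute:
  assumes f: "f holomorphic_on slit" and "i \<le> r" "j \<le> r"
  shows "diffop r i (raise j p) (diffop r j p f) = diffop r j (raise i p) (diffop r i p f)"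
proof (cases "i = j")
  case False
  have k: "snd (snd (raise n p)) = snd (snd p) + 1" for n
    by (cases p) (simp add: raise_def)
  show ?thesis
  proof
    fix z
    show "diffop r i (raise j p) (diffop r j p f) z = diffop r j (raise i p) (diffop r i p f) z"
    proof (cases "z \<in> slit")
      case True
      show ?thesis
        unfolding diffop_def[of r i "raise j p"] diffop_def[of r j "raise i p"]
        using True False assms
        by (simp add: deriv_diffop ee_raise k) (simp add: diffop_def algebra_simps)
    qed (simp add: diffop_def)
  qed
qed simp

lemma diffops_move:
  assumes "f holomorphic_on slit" "set (xs @ j # ys) \<subseteq> {0..r}"
  shows "diffops r (xs @ j # ys) p f = diffops r (j # xs @ ys) p f"
  using assms
proof (induction xs arbitrary: p f)
  case (Cons x xs)
  then have "diffops r (xs @ j # ys) (raise x p) (diffop r x p f)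
      = diffops r (j # xs @ ys) (raise x p) (diffop r x p f)"
    by (intro Cons.IH diffop_holomorphic) auto
  then show ?case
    using Cons.prems by (auto simp: diffop_commute[of f j r x] raise_commute[of j x])
qed simp

lemma diffops_perm:
  assumes "f holomorphic_on slit" "set xs \<subseteq> {0..r}" "mset xs = mset ys"
  shows "diffops r xs p f = diffops r ys p f"
  using assms
proof (induction xs arbitrary: ys p f)
  case (Cons x xs)
  from Cons.prems have "x \<in> set ys"
    by (metis list.set_intros(1) mset_eq_setD)
  then obtain as bs where ys: "ys = as @ x # bs"
    by (meson split_list)
  have "set ys \<subseteq> {0..r}"
    using Cons.prems by (metis mset_eq_setD)
  moreover have "mset xs = mset (as @ bs)"
    using Cons.prems ys by simp
  ultimately show ?case
    using Cons.prems Cons.IH[of "diffop r x p f" "as @ bs" "raise x p"] ys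
    by (auto simp: diffops_move intro!: diffop_holomorphic)
qed simp

lemma index_seq_count:
  assumes "index_seq r l k js" "i \<le> r"
  shows "int (count (mset js) i) = lext r l k i - lext r l k (i + 1)"
proof -
  have split: "int (card {s. s < k \<and> i \<le> js ! s}) - int (card {s. s < k \<and> i + 1 \<le> js ! s})
      = int (card {s. s < k \<and> js ! s = i})"
  proof -
    have "{s. s < k \<and> i \<le> js ! s} = {s. s < k \<and> i + 1 \<le> js ! s} \<union> {s. s < k \<and> js ! s = i}"
      by auto
    moreover have "card ({s. s < k \<and> i + 1 \<le> js ! s} \<union> {s. s < k \<and> js ! s = i})
      = card {s. s < k \<and> i + 1 \<le> js ! s} + card {s. s < k \<and> js ! s = i}"
      by (rule card_Un_disjoint) auto
    ultimately show ?thesis by simp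
  qed
  have lext: "lext r l k n = int (card {s. s < k \<and> n \<le> js ! s})" for n
  proof -
    consider "n = 0" | "1 \<le> n" "n \<le> r" | "n > r" "n \<noteq> 0" by linarith
    then show ?thesis
    proof cases
      case 2
      have "l n = (\<Sum>s<k. ones (js ! s) n)"
        using assms(1) by (simp add: index_seq_def)
      also have "\<dots> = (\<Sum>s<k. if n \<le> js ! s then 1 else 0)"
        using 2 by (simp add: ones_def)
      also have "\<dots> = int (card {s. s < k \<and> n \<le> js ! s})"
        by (simp add: sum.If_cases Int_def)
      finally show ?thesis using 2 by (simp add: lext_def)
    next
      case 3
      have "js ! s \<le> r" if "s < k" for s
        using assms(1) that nth_mem[of s js] by (metis atLeastAtMost_iff index_seq_def subsetD)
      with 3 have "{s. s < k \<and> n \<le> js ! s} = {}"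
        by fastforce
      then show ?thesis using 3 by (simp only: lext_def card.empty) auto
    qed (simp add: lext_def)
  qed
  show ?thesis
    using split assms by (simp add: lext count_mset count_list_eq_length_filter length_filter_conv_card index_seq_def)
       (simp add: eq_commute)
qed

lemma full_diffop_eq:
  assumes js: "index_seq r l k js" and f: "f holomorphic_on slit"
  shows "full_diffop r (m, l, k) f = diffops r js (m, (\<lambda>_. 0), 0) f"
proof -
  define js' where "js' = (SOME js. index_seq r l k js)"
  have js': "index_seq r l k js'"
    unfolding js'_def using js by (rule someI)
  have "count (mset js') i = count (mset js) i" for i
  proof (cases "i \<le> r")
    case True
    then have "int (count (mset js') i) = int (count (mset js) i)"
      using js js' by (simp only: index_seq_count)
    then show ?thesis by simp
  next
    case False
    then have "i \<notin> set js" "i \<notin> set js'"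
      using js js' by (auto simp: index_seq_def)
    then show ?thesis
      by (metis count_eq_zero_iff set_mset_mset)
  qed
  then have "mset js' = mset js"
    by (rule multiset_eqI)
  moreover have "set js' \<subseteq> {0..r}"
    using js' by (simp add: index_seq_def)
  ultimately show ?thesis
    using f by (simp add: full_diffop_def js'_def[symmetric] diffops_perm)
qed

end

theory Submission
  imports Defs
begin

text \<open>
  The commutation of the \<open>D\<^sub>i\<close> is that of the differential operators on holomorphic functions. The
  relation with \<open>s\<^sub>i\<close> holds because \<open>s\<^sub>i\<close> is nothing but multiplication by a power of \<open>x\<close>, the
  same on all summands that occur. The exponents satisfy
  \<open>c\<^sub>a(s\<^sub>i\<cdot>m) = c\<^bsub>s\<^sub>i(a)\<^esub>(m) - \<gamma>\<close>, where \<open>\<gamma> = 0\<close> for \<open>i > 1\<close>, while \<open>\<gamma> = m\<^sub>1 + 1\<close> for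
  \<open>i = 1\<close>: the normalization \<open>c\<^sub>0 = 0\<close> forces a shift when \<open>c\<^sub>0\<close> and \<open>c\<^sub>1\<close> are exchanged. The
  differences \<open>l\<^sub>a - l\<^bsub>a+1\<^esub>\<close> are permuted as well, so \<open>e\<^sub>a\<close> transforms like \<open>c\<^sub>a\<close>. Since conjugating
  \<open>x(x-1)d/dx\<close> by \<open>x\<^sup>\<gamma>\<close> adds \<open>\<gamma>(x-1)\<close>, this says that
  \<open>D\<^bsub>s\<^sub>i(j)\<^esub>(s\<^sub>i p) = x\<^bsup>-\<gamma>\<^esup> D\<^sub>j(p) x\<^sup>\<gamma>\<close>  (\<open>diffop_twist\<close>).

  Composing these identities along a sequence of indices and along its image under the
  transposition, one finds that the polynomials defining the two spaces are the same:
  \<open>v\<^bsub>s\<^sub>i(a)\<^esub>(s\<^sub>i p) = v\<^sub>a(p)\<close> (\<open>vpoly_s_param\<close>). Hence \<open>s\<^sub>i\<close> maps each basis function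
  \<open>v\<^sub>a x\<^bsup>c\<^sub>a\<^esup>\<close> to itself times \<open>x\<^bsup>-\<gamma>\<^esup>\<close> (\<open>s_map_eq_twist\<close>), and \<open>s\<^sub>i D\<^sub>j = D\<^bsub>s\<^sub>i(j)\<^esub> s\<^sub>i\<close> is the
  conjugation identity again. The description of \<open>s\<^sub>i\<close> may be applied after \<open>D\<^sub>j\<close> because \<open>D\<^sub>j\<close> maps
  the space at \<open>p\<close> into the space at the raised parameters (\<open>diffop_V\<close>).
\<close>

section \<open>Functions on the slit plane and multiplication by powers\<close>

lemma cpow_holomorphic: "cpow c holomorphic_on slit"
  by (rule holomorphic_transform[where f = "\<lambda>z. z powr c"])
     (auto simp: cpow_def slit_def intro!: holomorphic_intros)

definition twist :: "complex \<Rightarrow> cfun \<Rightarrow> cfun" where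
  "twist c f = (\<lambda>z. cpow (- c) z * f z)"

lemma twist_holomorphic: "f holomorphic_on slit \<Longrightarrow> twist c f holomorphic_on slit"
  unfolding twist_def by (intro holomorphic_intros cpow_holomorphic)

lemma twist_cpow: "twist c (cpow d) = cpow (d - c)"
proof
  show "twist c (cpow d) z = cpow (d - c) z" for z
    by (cases "z = 0") (auto simp: twist_def cpow_def slit_def powr_add[symmetric])
qed

lemma linear_twist: "Vector_Spaces.linear fscale fscale (twist c)"
  by unfold_locales (auto simp: twist_def fscale_def algebra_simps)

lemma deriv_twist:
  assumes f: "f holomorphic_on slit" and z: "z \<in> slit"
  shows "z * deriv (twist c f) z = cpow (- c) z * (z * deriv f z - c * f z)"
proof -
  have z0: "z \<noteq> 0" "z \<notin> \<real>\<^sub>\<le>\<^sub>0" using z by (auto simp: slit_def)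
  have f1: "(f has_field_derivative deriv f z) (at z)"
    using f z open_slit by (metis holomorphic_derivI)
  have p: "((\<lambda>z. z powr (- c)) has_field_derivative (- c * z powr (- c - 1))) (at z)"
    using z0 has_field_derivative_powr by blast
  have "((\<lambda>z. z powr (- c) * f z) has_field_derivative
      (- c * z powr (- c - 1) * f z + deriv f z * z powr (- c))) (at z)"
    by (rule DERIV_mult[OF p f1])
  then have "(twist c f has_field_derivative
      (- c * z powr (- c - 1) * f z + deriv f z * z powr (- c))) (at z)"
    by (rule has_field_derivative_transform_within_open[OF _ open_slit z])
       (simp add: twist_def cpow_def)
  then have "deriv (twist c f) z = - c * z powr (- c - 1) * f z + deriv f z * z powr (- c)"
    by (rule DERIV_imp_deriv)
  moreover have "z powr (- c - 1) = z powr (- c) / z"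
    using z0 by (simp add: powr_diff)
  ultimately show ?thesis
    using z z0 by (simp add: twist_def cpow_def field_simps)
qed

section \<open>Linearity of the differential operators\<close>

lemma diffop_add:
  assumes "f holomorphic_on slit" "g holomorphic_on slit"
  shows "diffop r i p (f + g) = diffop r i p f + diffop r i p g"
proof
  fix z
  show "diffop r i p (f + g) z = (diffop r i p f + diffop r i p g) z"
  proof (cases "z \<in> slit")
    case True
    then have "f field_differentiable at z" "g field_differentiable at z"
      using assms open_slit by (auto simp: holomorphic_on_imp_differentiable_at)
    then have "deriv (f + g) z = deriv f z + deriv g z"
      by (simp add: plus_fun_def)
    then show ?thesis using True by (simp add: diffop_def algebra_simps)
  qed (simp add: diffop_def)
qed

lemma diffop_fscale:
  assumes "f holomorphic_on slit"
  shows "diffop r i p (fscale a f) = fscale a (diffop r i p f)"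
proof
  fix z
  show "diffop r i p (fscale a f) z = fscale a (diffop r i p f) z"
  proof (cases "z \<in> slit")
    case True
    then have "f field_differentiable at z"
      using assms open_slit by (auto simp: holomorphic_on_imp_differentiable_at)
    then have "deriv (fscale a f) z = a * deriv f z"
      by (simp add: fscale_def)
    then show ?thesis using True by (simp add: diffop_def fscale_def algebra_simps)
  qed (simp add: diffop_def fscale_def)
qed

lemma diffop_zero: "diffop r i p 0 = 0"
  by (auto simp: diffop_def zero_fun_def fun_eq_iff)

text \<open>
  For the empty sequence nothing forces the result to vanish outside the slit plane, hence the
  assumption on \<open>f\<close>.
\<close>

lemma diffops_vanish_outside:
  assumes "\<And>z. z \<notin> slit \<Longrightarrow> f z = 0" "z \<notin> slit"
  shows "diffops r js p f z = 0"
  using assms by (induction js arbitrary: p f) (auto simp: diffop_def)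

lemma diffops_append:
  "diffops r (xs @ ys) p f = diffops r ys (fold raise xs p) (diffops r xs p f)"
  by (induction xs arbitrary: p f) auto

section \<open>Index sequences\<close>

lemma fold_raise:
  "fold raise js (m, l, k) = (m, (\<lambda>n. l n + (\<Sum>s<length js. ones (js ! s) n)), k + length js)"
  by (induction js arbitrary: l k) (auto simp: raise_def sum.lessThan_Suc_shift add.assoc
      simp del: sum.lessThan_Suc)

text \<open>
  Phrased as reaching \<open>(m, l, k)\<close> from the initial parameters by successive raising steps, the
  condition on a sequence can be handled one step at a time.
\<close>

lemma index_seq_iff_fold:
  "index_seq r l k js \<longleftrightarrow> set js \<subseteq> {0..r} \<and> fold raise js (m, (\<lambda>_. 0), 0) = (m, l, k)"
  by (auto simp: index_seq_def fold_raise fun_eq_iff)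

lemma index_seq_snoc:
  assumes "index_seq r l k js" "j \<le> r"
  shows "index_seq r (\<lambda>n. l n + ones j n) (k + 1) (js @ [j])"
  using assms by (auto simp: index_seq_iff_fold[where m = "\<lambda>_. 0"] raise_def)

text \<open>
  A sequence realizing \<open>l\<close> is given by the conjugate partition: its entry at position \<open>s\<close> counts the
  parts of \<open>l\<close> that exceed \<open>s\<close>.
\<close>

lemma index_seq_exists:
  assumes p: "(m, l, k) \<in> params r"
  shows "\<exists>js. index_seq r l k js"
proof -
  define b where "b s = card {n \<in> {1..r}. int s < l n}" for s :: nat
  have step: "lext r l k n \<ge> lext r l k (Suc n)" for n
    using p by (cases "n \<le> r") (auto simp: params_def lext_def)
  have anti: "lext r l k a \<ge> lext r l k c" if "a \<le> c" for a c
    by (rule lift_Suc_antimono_le[of "lext r l k", OF step that])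
  have mono: "l c \<le> l a" if "1 \<le> a" "a \<le> c" "c \<le> r" for a c
    using anti[of a c] that by (auto simp: lext_def)
  have bounds: "0 \<le> l n" "l n \<le> int k" if "1 \<le> n" "n \<le> r" for n
    using anti[of 0 n] anti[of n "Suc r"] that by (auto simp: lext_def)
  have b_iff: "n \<le> b s \<longleftrightarrow> int s < l n" if n: "1 \<le> n" "n \<le> r" for n s
  proof
    assume "int s < l n"
    then have "{1..n} \<subseteq> {a \<in> {1..r}. int s < l a}"
      using mono[OF _ _ n(2)] n by (auto intro: less_le_trans)
    from card_mono[OF _ this] show "n \<le> b s" by (simp add: b_def)
  next
    assume nb: "n \<le> b s"
    show "int s < l n"
    proof (rule ccontr)
      assume "\<not> int s < l n"
      then have "a < n" if "1 \<le> a" "a \<le> r" "int s < l a" for a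
        using mono[of n a] n that by linarith
      then have "{a \<in> {1..r}. int s < l a} \<subseteq> {1..<n}"
        by auto
      from card_mono[OF _ this] have "b s \<le> n - 1" by (simp add: b_def)
      with nb n show False by simp
    qed
  qed
  have b_le: "b s \<le> r" for s
    unfolding b_def by (rule order_trans[OF card_mono[of "{1..r}"]]) auto
  have "(\<Sum>s<k. ones (map b [0..<k] ! s) n) = l n" for n
  proof (cases "1 \<le> n \<and> n \<le> r")
    case True
    have "(\<Sum>s<k. ones (map b [0..<k] ! s) n) = (\<Sum>s<k. if int s < l n then 1 else 0)"
      using True by (intro sum.cong) (auto simp: ones_def b_iff)
    also have "\<dots> = int (card {s. s < k \<and> int s < l n})"
      by (simp add: sum.If_cases Int_def)
    also have "{s. s < k \<and> int s < l n} = {..<nat (l n)}"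
      using bounds[of n] True by auto
    finally show ?thesis using bounds[of n] True by simp
  next
    case False
    then have "l n = 0" using p by (auto simp: params_def)
    moreover have "ones (map b [0..<k] ! s) n = 0" if "s < k" for s
      using False b_le[of s] that by (auto simp: ones_def)
    ultimately show ?thesis by simp
  qed
  then have "index_seq r l k (map b [0..<k])"
    using b_le by (auto simp: index_seq_def)
  then show ?thesis ..
qed

lemma full_diffop_raise:
  assumes "(m, l, k) \<in> params r" "f holomorphic_on slit" "j \<le> r"
  shows "full_diffop r (raise j (m, l, k)) f = diffop r j (m, l, k) (full_diffop r (m, l, k) f)"
proof -
  obtain js where js: "index_seq r l k js"
    using index_seq_exists assms(1) by blast
  then have "fold raise js (m, (\<lambda>_. 0), 0) = (m, l, k)"
    using index_seq_iff_fold by blast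
  then show ?thesis
    using full_diffop_eq[OF index_seq_snoc[OF js assms(3)] assms(2)] full_diffop_eq[OF js assms(2)]
    by (simp add: raise_def diffops_append)
qed

section \<open>The basis functions\<close>

lemma infinite_slit: "infinite slit"
proof -
  have "1 \<in> slit" by (simp add: slit_def)
  then show ?thesis using open_slit finite_imp_not_open by blast
qed

lemma is_vpoly_unique:
  assumes v: "is_vpoly r p i v" and w: "is_vpoly r p i w"
  shows "v = w"
proof -
  obtain m l k where p: "p = (m, l, k)" by (cases p)
  obtain a b where a: "a \<noteq> 0" "\<forall>z\<in>slit. z powr (- cc m i) * full_diffop r p (cpow (cc m i)) z = a * poly v z"
    and b: "b \<noteq> 0" "\<forall>z\<in>slit. z powr (- cc m i) * full_diffop r p (cpow (cc m i)) z = b * poly w z"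
    using v w unfolding is_vpoly_def p prod.case by blast
  \<comment> \<open>two polynomials that agree on the infinite set \<open>slit\<close> are equal\<close>
  have "slit \<subseteq> {z. poly (smult a v - smult b w) z = 0}"
    using a b by auto
  then have "\<not> finite {z. poly (smult a v - smult b w) z = 0}"
    using infinite_slit finite_subset by blast
  then have "smult a v - smult b w = 0"
    using poly_roots_finite by blast
  then have eq: "smult a v = smult b w" by simp
  have "lead_coeff v = 1" "lead_coeff w = 1"
    using v w by (auto simp: is_vpoly_def p)
  moreover have "a * lead_coeff v = b * lead_coeff w"
    using eq by (metis lead_coeff_smult)
  ultimately have "a = b" by simp
  then have "smult a (v - w) = 0"
    using eq by (simp add: smult_diff_right)
  then show ?thesis using a(1) by simp
qed

lemma is_vpoly_vpoly: "is_vpoly r p i v \<Longrightarrow> is_vpoly r p i (vpoly r p i)"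
  unfolding vpoly_def by (rule theI[of _ v], assumption) (rule is_vpoly_unique)

lemma full_diffop_cpow:
  assumes "is_vpoly r (m, l, k) i v"
  shows "\<exists>a. a \<noteq> 0 \<and> full_diffop r (m, l, k) (cpow (cc m i)) = fscale a (vfun r (m, l, k) i)"
proof -
  let ?p = "(m, l, k)"
  obtain a where a: "a \<noteq> 0" "\<forall>z\<in>slit. z powr (- cc m i) * full_diffop r ?p (cpow (cc m i)) z
      = a * poly (vpoly r ?p i) z"
    using is_vpoly_vpoly[OF assms] by (auto simp: is_vpoly_def)
  have "full_diffop r ?p (cpow (cc m i)) z = fscale a (vfun r ?p i) z" for z
  proof (cases "z \<in> slit")
    case True
    then have z0: "z \<noteq> 0" by (auto simp: slit_def)
    then have "full_diffop r ?p (cpow (cc m i)) z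
        = z powr (cc m i) * (z powr (- cc m i) * full_diffop r ?p (cpow (cc m i)) z)"
      by (simp add: powr_minus)
    also have "\<dots> = z powr (cc m i) * (a * poly (vpoly r ?p i) z)"
      using a(2) True by simp
    finally show ?thesis
      using True by (simp add: fscale_def vfun_def cpow_def)
  next
    case False
    have "full_diffop r ?p (cpow (cc m i)) z = 0"
      using False unfolding full_diffop_def prod.case
      by (intro diffops_vanish_outside) (auto simp: cpow_def)
    then show ?thesis using False by (simp add: fscale_def vfun_def cpow_def)
  qed
  with a(1) show ?thesis by blast
qed

lemma vfun_holomorphic: "vfun r p i holomorphic_on slit"
  unfolding vfun_def by (intro holomorphic_intros cpow_holomorphic)

lemma V_holomorphic:
  assumes "f \<in> V r p"
  shows "f holomorphic_on slit"
  using assms unfolding V_def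
proof (induction rule: cfun.span_induct_alt)
  case base
  show ?case by (simp add: zero_fun_def)
next
  case (step c x y)
  then have "(\<lambda>z. c * x z + y z) holomorphic_on slit"
    by (auto intro!: holomorphic_intros vfun_holomorphic)
  then show ?case by (simp add: fscale_def plus_fun_def)
qed

text \<open>
  Up to nonzero factors the basis functions at \<open>p\<close> and at the raised parameters are
  \<open>D\<^sub>p x\<^bsup>c\<^sub>a\<^esup>\<close> and \<open>D\<^sub>j(p) D\<^sub>p x\<^bsup>c\<^sub>a\<^esup>\<close>, with the same exponents \<open>c\<^sub>a\<close>.
\<close>

lemma diffop_V:
  assumes p: "admissible r p" and q: "admissible r (raise j p)" and j: "j \<le> r"
    and f: "f \<in> V r p"
  shows "diffop r j p f \<in> V r (raise j p)"
proof -
  obtain m l k where pe: "p = (m, l, k)" by (cases p)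
  define l' where "l' = (\<lambda>n. l n + ones j n)"
  have qe: "raise j p = (m, l', k + 1)" by (simp add: pe raise_def l'_def)
  have basis: "diffop r j p (vfun r p a) \<in> V r (raise j p)" if a: "a \<le> r" for a
  proof -
    obtain v w where "is_vpoly r p a v" "is_vpoly r (raise j p) a w"
      using p q a unfolding admissible_def by blast
    then obtain x y where x: "x \<noteq> 0" "full_diffop r p (cpow (cc m a)) = fscale x (vfun r p a)"
      and y: "full_diffop r (raise j p) (cpow (cc m a)) = fscale y (vfun r (raise j p) a)"
      using full_diffop_cpow[of r m l k a v] full_diffop_cpow[of r m l' "k + 1" a w]
      unfolding qe unfolding pe by blast
    have "fscale x (diffop r j p (vfun r p a)) = fscale y (vfun r (raise j p) a)"
      using full_diffop_raise[of m l k r "cpow (cc m a)" j] p j x y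
      by (simp add: pe admissible_def cpow_holomorphic diffop_fscale vfun_holomorphic)
    then have "fscale (inverse x) (fscale x (diffop r j p (vfun r p a)))
        = fscale (inverse x) (fscale y (vfun r (raise j p) a))"
      by simp
    then have "diffop r j p (vfun r p a) = fscale (inverse x * y) (vfun r (raise j p) a)"
      using x(1) by (simp add: cfun.scale_scale)
    then show ?thesis
      using a by (simp add: V_def cfun.span_scale cfun.span_base)
  qed
  from f have "f holomorphic_on slit \<and> diffop r j p f \<in> V r (raise j p)"
    unfolding V_def[of r p]
  proof (induction rule: cfun.span_induct_alt)
    case base
    show ?case
      using diffop_zero[of r j p] cfun.span_zero[of "vfun r (raise j p) ` {0..r}"]
      by (simp add: V_def zero_fun_def)
  next
    case (step c x y)
    then have x: "x holomorphic_on slit" "diffop r j p x \<in> V r (raise j p)"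
      using basis by (auto intro: vfun_holomorphic)
    have cx: "fscale c x holomorphic_on slit"
      unfolding fscale_def by (intro holomorphic_intros x)
    have "fscale c x + y holomorphic_on slit"
      using cx step by (auto simp: plus_fun_def intro!: holomorphic_intros)
    moreover have "diffop r j p (fscale c x + y) \<in> V r (raise j p)"
      using x cx step by (simp add: diffop_add diffop_fscale V_def cfun.span_add cfun.span_scale)
    ultimately show ?case by blast
  qed
  then show ?thesis ..
qed

section \<open>The action of the transpositions on the parameters\<close>

text \<open>
  The exponent \<open>\<gamma>\<close>: the amount by which \<open>s\<^sub>i\<close> lowers every \<open>c\<^sub>a\<close>, besides permuting them.
\<close>

definition shift :: "nat \<Rightarrow> (nat \<Rightarrow> complex) \<Rightarrow> complex" where
  "shift i m = (if i = 1 then m 1 + 1 else 0)"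

lemma s_perm_simps:
  "s_perm i (i - 1) = i" "s_perm i i = i - 1"
  "a \<noteq> i - 1 \<Longrightarrow> a \<noteq> i \<Longrightarrow> s_perm i a = a" "s_perm i (s_perm i a) = a"
  by (auto simp: s_perm_def)

lemma s_perm_le: "i \<le> r \<Longrightarrow> a \<le> r \<Longrightarrow> s_perm i a \<le> r"
  by (auto simp: s_perm_def Transposition.transpose_def)

lemma cc_Suc: "cc m (Suc n) = cc m n + m (Suc n) + 1"
  by (simp add: cc_def)

text \<open>
  Replacing \<open>m\<^sub>i\<close> by \<open>- m\<^sub>i - 2\<close> reverses the sign of the increment \<open>c\<^sub>i - c\<^bsub>i-1\<^esub> = m\<^sub>i + 1\<close>; the changes of
  the two neighbours enlarge the adjacent increments by \<open>m\<^sub>i + 1\<close>, as exchanging the two values requires. For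
  \<open>i = 1\<close> there is no increment before \<open>c\<^sub>0\<close> to enlarge, so all values end up lower by \<open>m\<^sub>1 + 1\<close>.
\<close>

lemma cc_s_m:
  assumes i: "1 \<le> i" "i \<le> r" and a: "a \<le> r"
  shows "cc (s_m r i m) a = cc m (s_perm i a) - shift i m"
  using a
proof (induction a)
  case 0
  show ?case
    using i by (auto simp: cc_def shift_def s_perm_def Transposition.transpose_def)
next
  case (Suc n)
  then have IH: "cc (s_m r i m) n = cc m (s_perm i n) - shift i m" by simp
  obtain i' where i': "i = Suc i'" using i by (cases i) auto
  consider "n = i'" | "n = i" | "Suc n = i'" | "n \<noteq> i'" "n \<noteq> i" "Suc n \<noteq> i'" by blast
  then show ?case
    by cases (use Suc.prems IH i' i in \<open>auto simp: cc_Suc s_m_def s_perm_def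
        Transposition.transpose_def shift_def\<close>)
qed

lemma lext_s_l:
  assumes "1 \<le> i" "i \<le> r"
  shows "lext r (s_l r i k l) k n
    = (if n = i then lext r l k (i - 1) + lext r l k (i + 1) - lext r l k i else lext r l k n)"
  using assms by (auto simp: lext_def s_l_def)

lemma dd_s_l:
  assumes "1 \<le> i" "i \<le> r"
  shows "dd r (s_l r i k l) k (s_perm i a) = dd r l k a"
  unfolding dd_def lext_s_l[OF assms]
  using assms by (cases i) (auto simp: s_perm_def Transposition.transpose_def)

lemma ee_s_param:
  assumes i: "1 \<le> i" "i \<le> r" and a: "a \<le> r"
  shows "ee r (s_param r i p) (s_perm i a) = ee r p a - shift i (fst p)"
proof -
  obtain m l k where p: "p = (m, l, k)" by (cases p)
  have ee: "ee r (m, l, k) a = cc m a + of_int (dd r l k a)" for m l k a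
    by (simp add: ee_def dd_def)
  show ?thesis
    using cc_s_m[OF i s_perm_le[OF i(2) a]]
    by (simp add: p s_param_def ee dd_s_l[OF i] s_perm_simps)
qed

lemma s_param_raise:
  assumes i: "1 \<le> i" "i \<le> r" and j: "j \<le> r"
  shows "s_param r i (raise j p) = raise (s_perm i j) (s_param r i p)"
proof -
  obtain m l k where p: "p = (m, l, k)" by (cases p)
  have "s_l r i (k + 1) (\<lambda>n. l n + ones j n) n = s_l r i k l n + ones (s_perm i j) n" for n
    using i j by (cases i)
      (auto simp: s_l_def lext_def ones_def s_perm_def Transposition.transpose_def)
  then show ?thesis by (auto simp: p s_param_def raise_def)
qed

lemma s_param_fold_raise:
  assumes i: "1 \<le> i" "i \<le> r" and js: "set js \<subseteq> {0..r}"
  shows "s_param r i (fold raise js p) = fold raise (map (s_perm i) js) (s_param r i p)"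
  using js by (induction js arbitrary: p) (auto simp: s_param_raise[OF i])

lemma s_param_initial: "s_param r i (m, (\<lambda>_. 0), 0) = (s_m r i m, (\<lambda>_. 0), 0)"
  by (auto simp: s_param_def s_l_def lext_def)

text \<open>
  Since \<open>s\<^sub>i\<close> carries raising by \<open>j\<close> to raising by \<open>s\<^sub>i(j)\<close> and fixes the initial \<open>l = 0\<close>, \<open>k = 0\<close>, it
  carries the path of a sequence to the path of the permuted sequence.
\<close>

lemma index_seq_s_l:
  assumes i: "1 \<le> i" "i \<le> r" and js: "index_seq r l k js"
  shows "index_seq r (s_l r i k l) k (map (s_perm i) js)"
proof -
  have set: "set js \<subseteq> {0..r}" and "fold raise js (\<lambda>_. 0, \<lambda>_. 0, 0) = (\<lambda>_. 0, l, k)"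
    using js index_seq_iff_fold[of r l k js "\<lambda>_. 0"] by auto
  then have "fold raise (map (s_perm i) js) (s_m r i (\<lambda>_. 0), (\<lambda>_. 0), 0)
      = (s_m r i (\<lambda>_. 0), s_l r i k l, k)"
    using s_param_fold_raise[OF i set, of "(\<lambda>_. 0, \<lambda>_. 0, 0)"]
    by (simp add: s_param_initial) (simp add: s_param_def)
  moreover have "set (map (s_perm i) js) \<subseteq> {0..r}"
    using set s_perm_le[OF i(2)] by auto
  ultimately show ?thesis using index_seq_iff_fold by blast
qed

section \<open>The transpositions act by multiplication by a power\<close>

lemma diffop_twist:
  assumes i: "1 \<le> i" "i \<le> r" and j: "j \<le> r" and f: "f holomorphic_on slit"
  shows "diffop r (s_perm i j) (s_param r i p) (twist (shift i (fst p)) f)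
    = twist (shift i (fst p)) (diffop r j p f)"
proof
  fix z
  let ?c = "shift i (fst p)"
  have k: "snd (snd (s_param r i p)) = snd (snd p)"
    by (cases p) (simp add: s_param_def)
  show "diffop r (s_perm i j) (s_param r i p) (twist ?c f) z = twist ?c (diffop r j p f) z"
  proof (cases "z \<in> slit")
    case True
    have dz: "z * (z - 1) * deriv (twist ?c f) z
        = (z - 1) * (cpow (- ?c) z * (z * deriv f z - ?c * f z))"
      using deriv_twist[OF f True, of ?c] by (simp add: mult_ac)
    show ?thesis
      unfolding diffop_def[of r "s_perm i j"] ee_s_param[OF i j] k dz
      using True by (simp add: twist_def diffop_def algebra_simps)
  qed (simp add: diffop_def twist_def)
qed

lemma diffops_twist:
  assumes i: "1 \<le> i" "i \<le> r" and "set js \<subseteq> {0..r}" "f holomorphic_on slit"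
  shows "diffops r (map (s_perm i) js) (s_param r i p) (twist (shift i (fst p)) f)
    = twist (shift i (fst p)) (diffops r js p f)"
  using assms(3,4)
proof (induction js arbitrary: p f)
  case (Cons j js)
  have "fst (raise j p) = fst p" by (cases p) (simp add: raise_def)
  then show ?case
    using Cons.prems Cons.IH[of "diffop r j p f" "raise j p"]
    by (simp add: diffop_twist[OF i] diffop_holomorphic s_param_raise[OF i, symmetric])
qed simp

lemma full_diffop_twist:
  assumes i: "1 \<le> i" "i \<le> r" and p: "(m, l, k) \<in> params r" and f: "f holomorphic_on slit"
  shows "full_diffop r (s_param r i (m, l, k)) (twist (shift i m) f)
    = twist (shift i m) (full_diffop r (m, l, k) f)"
proof -
  obtain js where js: "index_seq r l k js"
    using index_seq_exists p by blast
  then have "set js \<subseteq> {0..r}" by (simp add: index_seq_def)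
  from diffops_twist[OF i this f, of "(m, (\<lambda>_. 0), 0)"] show ?thesis
    using full_diffop_eq[OF js f] full_diffop_eq[OF index_seq_s_l[OF i js] twist_holomorphic[OF f]]
    by (simp add: s_param_initial) (simp add: s_param_def)
qed

text \<open>
  The exponent \<open>c\<^bsub>s\<^sub>i(a)\<^esub>(s\<^sub>i\<cdot>m) = c\<^sub>a(m) - \<gamma>\<close> and the factor \<open>x\<^bsup>-\<gamma>\<^esup>\<close> from conjugating the operator
  cancel in \<open>x\<^bsup>-c\<^esup> D x\<^bsup>c\<^esup>\<close>, so the polynomial is characterized by the same condition for both
  parameters.
\<close>

lemma vpoly_s_param:
  assumes i: "1 \<le> i" "i \<le> r" and p: "p \<in> params r" and a: "a \<le> r"
  shows "vpoly r (s_param r i p) (s_perm i a) = vpoly r p a"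
proof -
  obtain m l k where pe: "p = (m, l, k)" by (cases p)
  let ?q = "(s_m r i m, s_l r i k l, k)"
  have q: "s_param r i (m, l, k) = ?q" by (simp add: s_param_def)
  have c: "cc (s_m r i m) (s_perm i a) = cc m a - shift i m"
    using cc_s_m[OF i s_perm_le[OF i(2) a]] by (simp add: s_perm_simps)
  have F: "full_diffop r ?q (cpow (cc m a - shift i m))
      = twist (shift i m) (full_diffop r (m, l, k) (cpow (cc m a)))"
    using full_diffop_twist[OF i p[unfolded pe] cpow_holomorphic] by (simp add: q twist_cpow)
  have eq: "z powr (- (cc m a - shift i m)) * twist (shift i m) f z = z powr (- cc m a) * f z"
    if "z \<in> slit" for z f
  proof -
    have "z \<noteq> 0" using that by (auto simp: slit_def)
    then have "z powr (shift i m - cc m a) * z powr (- shift i m) = z powr (- cc m a)"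
      by (simp add: powr_add[symmetric])
    then show ?thesis using that by (simp add: twist_def cpow_def mult.assoc[symmetric])
  qed
  have "is_vpoly r ?q (s_perm i a) = is_vpoly r (m, l, k) a"
    by (rule ext) (simp add: is_vpoly_def c F eq dd_s_l[OF i] del: minus_diff_eq)
  then show ?thesis by (simp add: vpoly_def pe q)
qed

lemma vfun_s_param:
  assumes i: "1 \<le> i" "i \<le> r" and p: "p \<in> params r" and a: "a \<le> r"
  shows "vfun r (s_param r i p) (s_perm i a) = twist (shift i (fst p)) (vfun r p a)"
proof -
  have c: "cc (fst (s_param r i p)) (s_perm i a) = cc (fst p) a - shift i (fst p)"
    using cc_s_m[OF i s_perm_le[OF i(2) a]] by (cases p) (simp add: s_perm_simps s_param_def)
  show ?thesis
    unfolding vfun_def vpoly_s_param[OF assms] c twist_cpow[symmetric] by (auto simp: twist_def)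
qed

lemma s_map_spec:
  assumes i: "1 \<le> i" "i \<le> r" and p: "p \<in> params r"
  shows "Vector_Spaces.linear fscale fscale (s_map r i p)"
    and "j \<le> r \<Longrightarrow> s_map r i p (vfun r p j) = vfun r (s_param r i p) (s_perm i j)"
proof -
  have "\<exists>T. Vector_Spaces.linear fscale fscale T \<and>
     (\<forall>j\<le>r. T (vfun r p j) = vfun r (s_param r i p) (s_perm i j))"
    using linear_twist vfun_s_param[OF assms] by metis
  from someI_ex[OF this]
  show "Vector_Spaces.linear fscale fscale (s_map r i p)"
    and "j \<le> r \<Longrightarrow> s_map r i p (vfun r p j) = vfun r (s_param r i p) (s_perm i j)"
    unfolding s_map_def by auto
qed

lemma s_map_eq_twist:
  assumes i: "1 \<le> i" "i \<le> r" and p: "p \<in> params r" and f: "f \<in> V r p"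
  shows "s_map r i p f = twist (shift i (fst p)) f"
proof -
  interpret vector_space_pair fscale fscale by unfold_locales
  show ?thesis
    using linear_eq_on_span[OF s_map_spec(1)[OF i p] linear_twist _ f[unfolded V_def]]
      s_map_spec(2)[OF i p] vfun_s_param[OF i p] by fastforce
qed

section \<open>The operators on the direct sum\<close>

text \<open>
  The sum in \<open>lift_op\<close> runs over nonzero components only; the condition \<open>T p 0 = 0\<close> makes a vanishing
  component agree with the general formula.
\<close>

lemma lift_op_single:
  assumes "\<And>q. q \<noteq> p \<Longrightarrow> F q = 0" "T p 0 = 0"
  shows "lift_op g T F = (\<lambda>q. if q = g p then T p (F p) else 0)"
proof
  fix q
  have only: "p' = p" if "F p' \<noteq> 0" for p'
    using assms(1) that by blast
  have "{p'. F p' \<noteq> 0 \<and> g p' = q} = (if F p \<noteq> 0 \<and> q = g p then {p} else {})"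
  proof (cases "F p \<noteq> 0 \<and> q = g p")
    case True
    show ?thesis unfolding if_P[OF True] using True only by blast
  next
    case False
    show ?thesis unfolding if_not_P[OF False] using False only by blast
  qed
  then show "lift_op g T F q = (if q = g p then T p (F p) else 0)"
    using assms(2) by (auto simp: lift_op_def)
qed

lemma lift_op_lift_op_single:
  assumes F: "\<And>q. q \<noteq> p \<Longrightarrow> F q = 0" and T: "T p 0 = 0" "T' (g p) 0 = 0"
  shows "lift_op g' T' (lift_op g T F) = (\<lambda>q. if q = g' (g p) then T' (g p) (T p (F p)) else 0)"
  using lift_op_single[where F = "lift_op g T F" and p = "g p" and T = T' and g = g']
    lift_op_single[where F = F and p = p and T = T and g = g] assms by auto

theorem lemma7p3:
  fixes r :: nat
  assumes "r \<ge> 1"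
  shows "(\<forall>i\<in>{0..r}. \<forall>j\<in>{0..r}. \<forall>p. \<forall>F\<in>summand r p.
            admissible r p \<and> admissible r (raise i p) \<and> admissible r (raise j p) \<and>
            admissible r (raise i (raise j p)) \<and> admissible r (raise j (raise i p)) \<longrightarrow>
            D r i (D r j F) = D r j (D r i F)) \<and>
         (\<forall>i\<in>{1..r}. \<forall>j\<in>{0..r}. \<forall>p. \<forall>F\<in>summand r p.
            admissible r p \<and> admissible r (raise j p) \<and> admissible r (s_param r i p) \<and>
            admissible r (s_param r i (raise j p)) \<and>
            admissible r (raise (s_perm i j) (s_param r i p)) \<longrightarrow>
            S r i (D r j F) = D r (s_perm i j) (S r i F))"
proof -
  have single: "F q = 0" if "F \<in> summand r p" "q \<noteq> p" for F q p
    using that unfolding summand_def by blast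
  have FV: "F p \<in> V r p" if "F \<in> summand r p" for F p
  proof (cases "F p = 0")
    case True
    then show ?thesis
      using cfun.span_zero[of "vfun r p ` {0..r}"] by (simp add: V_def)
  next
    case False
    then show ?thesis using that unfolding summand_def Vsum_def by blast
  qed
  show ?thesis
  proof (intro conjI ballI allI impI)
    fix i j p F
    assume i: "i \<in> {0..r}" and j: "j \<in> {0..r}" and F: "F \<in> summand r p"
    have DD: "D r a (D r b F) = (\<lambda>q. if q = raise a (raise b p)
        then diffop r a (raise b p) (diffop r b p (F p)) else 0)" for a b
      unfolding D_def by (rule lift_op_lift_op_single) (auto simp: single[OF F] diffop_zero)
    show "D r i (D r j F) = D r j (D r i F)"
      using diffop_commute[OF V_holomorphic[OF FV[OF F]], of i r j p] i j
      by (simp add: DD raise_commute[of i j] cong: if_cong)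
  next
    fix i j p F
    assume "i \<in> {1..r}" and j: "j \<in> {0..r}" and F: "F \<in> summand r p"
      and adm: "admissible r p \<and> admissible r (raise j p) \<and> admissible r (s_param r i p) \<and>
            admissible r (s_param r i (raise j p)) \<and>
            admissible r (raise (s_perm i j) (s_param r i p))"
    then have i: "1 \<le> i" "i \<le> r" and p: "p \<in> params r" and q: "raise j p \<in> params r"
      by (auto simp: admissible_def)
    have zero: "s_map r i p' 0 = 0" if "p' \<in> params r" for p'
      using s_map_spec(1)[OF i that] by (metis Vector_Spaces.linear_iff_module_hom module_hom.zero)
    have fst: "fst (raise j p) = fst p" by (cases p) (simp add: raise_def)
    have DjF: "diffop r j p (F p) \<in> V r (raise j p)"
      using adm j diffop_V FV[OF F] by auto
    have "S r i (D r j F) = (\<lambda>q. if q = s_param r i (raise j p)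
        then s_map r i (raise j p) (diffop r j p (F p)) else 0)"
      unfolding D_def S_def
      by (rule lift_op_lift_op_single) (auto simp: single[OF F] diffop_zero zero q)
    moreover have "D r (s_perm i j) (S r i F) = (\<lambda>q. if q = raise (s_perm i j) (s_param r i p)
        then diffop r (s_perm i j) (s_param r i p) (s_map r i p (F p)) else 0)"
      unfolding D_def S_def
      by (rule lift_op_lift_op_single) (auto simp: single[OF F] diffop_zero zero p)
    moreover have "s_map r i (raise j p) (diffop r j p (F p))
        = diffop r (s_perm i j) (s_param r i p) (s_map r i p (F p))"
      using s_map_eq_twist[OF i q DjF] s_map_eq_twist[OF i p FV[OF F]] fst
        diffop_twist[OF i _ V_holomorphic[OF FV[OF F]], of j p] j by simp
    ultimately show "S r i (D r j F) = D r (s_perm i j) (S r i F)"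
      using s_param_raise[OF i, of j p] j by (simp cong: if_cong)
  qed
qed

end
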